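(* Let $\mathcal X,\mathcal Z$ be Banach spaces, $E\in\mathcal L(\mathcal X,\mathcal Z)$, $A\colon\mathcal D(A)\subseteq\mathcal X\to\mathcal Z$ closed, linear and densely defined, with $\rho(E,A)\neq\emptyset$. (a) If the differentiation index $p_{\rm diff}^{(E,A)}$ exists, then the chain index $p_{\rm chain}^{(E,A)}$ exists and $p_{\rm chain}^{(E,A)}\le p_{\rm diff}^{(E,A)}$. (b) If the nilpotency index $p_{\rm nilp}^{(E,A)}$ exists and the operator $A_1$ in the Weierstraß form generates a $C_0$-semigroup, then the differentiation index exists and $p_{\rm nilp}^{(E,A)}=p_{\rm diff}^{(E,A)}$.
   Context: $\rho(E,A)$ is the set of $\lambda\in\mathbb C$ for which $\lambda E-A\colon\mathcal D(A)\to\mathcal Z$ has an inverse $(\lambda E-A)^{-1}\in\mathcal L(\mathcal Z,\mathcal X)$. Differentiation index: for $\mu\in\mathbb N_0$ let $M_\mu\colon\mathcal D(A)^{\mu+1}\times\mathcal X\to\mathcal Z^{\mu+1}$, $M_\mu(x_0,\dots,x_{\mu+1})=(Ax_0-Ex_1,\ Ax_1-Ex_2,\ \dots,\ Ax_\mu-Ex_{\mu+1})$. The differentiation index is the smallest $\mu\in\mathbb N_0$ for which there exist a Banach space $\tilde{\mathcal X}$ densely embedded into $\mathcal X$ and a generator $(S,\mathcal D(S))$ of a strongly continuous semigroup on $\tilde{\mathcal X}$ such that $(x_0,\dots,x_{\mu+1})\in\ker M_\mu$ implies $x_0\in\mathcal D(S)$ and $x_1=Sx_0$. Chain index: a chain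 of $(E,A)$ of length $p\in\mathbb N$ is a tuple $(x_1,\dots,x_p)\in\mathcal D(A)^{p-1}\times\mathcal X$ with $x_1\in\ker E\setminus\{0\}$, $x_k\notin\ker A$ for $k=1,\dots,p-1$, and $Ex_{k+1}=Ax_k$ for $k=1,\dots,p-1$. The chain index is the supremum of all chain lengths ($0$ if there are no chains); it exists only if this supremum is finite. Equivalence: $(E,A)\sim(\tilde E,\tilde A)$ (with $\tilde E\in\mathcal L(\tilde{\mathcal X},\tilde{\mathcal Z})$, $\tilde A$ from $\tilde{\mathcal X}$ to $\tilde{\mathcal Z}$) if there are bounded isomorphisms $P\colon\mathcal X\to\tilde{\mathcal X}$, $Q\colon\mathcal Z\to\tilde{\mathcal Z}$ with $E=Q^{-1}\tilde EP$, $A=Q^{-1}\tilde AP$. Weierstraß form: $(E,A)$ has a Weierstraß form if there is a Hilbert space $\mathcal Y=\mathcal Y^1\oplus\mathcal Y^2$ with $(E,A)\sim\left(\begin{bmatrix}I_{\mathcal Y^1}&0\\0&N\end{bmatrix},\begin{bmatrix}A_1&0\\0&I_{\mathcal Y^2}\end{bmatrix}\right)$, where $N\in\mathcal L(\mathcal Y^2)$ is nilpotent and $A_1\colon\mathcal D(A_1)\subseteq\mathcal Y^1\to\mathcal Y^1$ is linear. The degree of nilpotency of $N$ is the number $p$ with $N^p=0$ and $N^l\ne0$ for $l<p$. Nilpotency index: defined if $(E,A)$ has a Weierstraß form; it is the degree of nilpotency of $N$, and $0$ if $N$ is absent (i.e. $(E,A)\sim(I_{\mathcal Y^1},A_1)$).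 *)

theory Defs
  imports "HOL-Analysis.Analysis"
begin

section \<open>Complex Banach and Hilbert spaces\<close>

class complex_normed_vector = real_normed_vector +
  fixes scaleC :: "complex \<Rightarrow> 'a \<Rightarrow> 'a"  (infixr \<open>*\<^sub>C\<close> 75)
  assumes scaleC_add_right: "c *\<^sub>C (x + y) = c *\<^sub>C x + c *\<^sub>C y"
    and scaleC_add_left: "(c + d) *\<^sub>C x = c *\<^sub>C x + d *\<^sub>C x"
    and scaleC_scaleC: "c *\<^sub>C d *\<^sub>C x = (c * d) *\<^sub>C x"
    and scaleC_of_real: "complex_of_real r *\<^sub>C x = r *\<^sub>R x"
    and norm_scaleC: "norm (c *\<^sub>C x) = cmod c * norm x"

class complex_banach = complex_normed_vector + banach

class complex_hilbert = complex_banach +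
  fixes cinner :: "'a \<Rightarrow> 'a \<Rightarrow> complex"
  assumes cinner_commute: "cinner x y = cnj (cinner y x)"
    and cinner_add_left: "cinner (x + y) z = cinner x z + cinner y z"
    and cinner_scaleC_left: "cinner (c *\<^sub>C x) y = c * cinner x y"
    and cinner_self: "cinner x x = complex_of_real ((norm x)\<^sup>2)"

text \<open>The product type is the Hilbert space direct sum: its library norm is
  \<open>sqrt ((norm x)\<^sup>2 + (norm y)\<^sup>2)\<close>.\<close>

instantiation prod :: (complex_normed_vector, complex_normed_vector) complex_normed_vector
begin

definition scaleC_prod_def: "c *\<^sub>C p = (c *\<^sub>C fst p, c *\<^sub>C snd p)"

instance
proof
  fix c d :: complex and r :: real and x y :: "'a \<times> 'b"
  show "c *\<^sub>C (x + y) = c *\<^sub>C x + c *\<^sub>C y"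
    by (simp add: scaleC_prod_def scaleC_add_right)
  show "(c + d) *\<^sub>C x = c *\<^sub>C x + d *\<^sub>C x"
    by (simp add: scaleC_prod_def scaleC_add_left)
  show "c *\<^sub>C d *\<^sub>C x = (c * d) *\<^sub>C x"
    by (simp add: scaleC_prod_def scaleC_scaleC)
  show "complex_of_real r *\<^sub>C x = r *\<^sub>R x"
    by (simp add: scaleC_prod_def scaleC_of_real prod_eq_iff)
  have "norm (c *\<^sub>C x) = sqrt ((cmod c)\<^sup>2 * ((norm (fst x))\<^sup>2 + (norm (snd x))\<^sup>2))"
    by (simp add: scaleC_prod_def norm_prod_def norm_scaleC power_mult_distrib distrib_left)
  then show "norm (c *\<^sub>C x) = cmod c * norm x"
    by (simp add: norm_prod_def real_sqrt_mult)
qed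

end

instance prod :: (complex_banach, complex_banach) complex_banach ..

instantiation prod :: (complex_hilbert, complex_hilbert) complex_hilbert
begin

definition cinner_prod_def: "cinner p q = cinner (fst p) (fst q) + cinner (snd p) (snd q)"

instance
proof
  fix c :: complex and x y z :: "'a \<times> 'b"
  show "cinner x y = cnj (cinner y x)"
    by (metis cinner_prod_def cinner_commute complex_cnj_add)
  show "cinner (x + y) z = cinner x z + cinner y z"
    by (simp add: cinner_prod_def cinner_add_left)
  show "cinner (c *\<^sub>C x) y = c * cinner x y"
    by (simp add: cinner_prod_def scaleC_prod_def cinner_scaleC_left distrib_left)
  show "cinner x x = complex_of_real ((norm x)\<^sup>2)"
    by (simp add: cinner_prod_def cinner_self norm_prod_def)
qed

end

text \<open>The one-element type is the zero Hilbert space; it is the summand that is used when a block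
  of the Weierstrass form is absent.\<close>

instantiation unit :: complex_normed_vector
begin

definition zero_unit_def: "(0::unit) = ()"
definition plus_unit_def: "(x::unit) + y = ()"
definition scaleR_unit_def: "r *\<^sub>R (x::unit) = ()"
definition scaleC_unit_def: "c *\<^sub>C (x::unit) = ()"
definition sgn_unit_def: "sgn (x::unit) = ()"
definition norm_unit_def: "norm (x::unit) = 0"
definition dist_unit_def: "dist (x::unit) y = 0"
definition uniformity_unit_def:
  "(uniformity :: (unit \<times> unit) filter) = (INF e\<in>{0<..}. principal {(x, y). dist x y < e})"
definition open_unit_def:
  "open (U :: unit set) = (\<forall>x\<in>U. eventually (\<lambda>(x', y). x' = x \<longrightarrow> y \<in> U) uniformity)"

instance
  by standard (auto simp: scaleR_unit_def scaleC_unit_def norm_unit_def dist_unit_def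
      uniformity_unit_def open_unit_def)

end

instance unit :: complex_banach
proof
  fix X :: "nat \<Rightarrow> unit"
  have "X = (\<lambda>_. ())"
    by auto
  then show "convergent X"
    by (simp add: convergent_const)
qed

instantiation unit :: complex_hilbert
begin

definition cinner_unit_def: "cinner (x::unit) y = 0"

instance
  by standard (auto simp: cinner_unit_def norm_unit_def)

end


section \<open>Linear operators\<close>

definition complex_subspace :: "'a::complex_normed_vector set \<Rightarrow> bool" where
  "complex_subspace V \<longleftrightarrow> 0 \<in> V \<and> (\<forall>x\<in>V. \<forall>y\<in>V. x + y \<in> V) \<and> (\<forall>c. \<forall>x\<in>V. c *\<^sub>C x \<in> V)"

text \<open>An unbounded operator is given by its domain \<open>D\<close> and a total function that matters only
  on \<open>D\<close>.\<close>

definition linear_operator ::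
    "'a::complex_normed_vector set \<Rightarrow> ('a \<Rightarrow> 'b::complex_normed_vector) \<Rightarrow> bool" where
  "linear_operator D A \<longleftrightarrow> complex_subspace D \<and>
     (\<forall>x\<in>D. \<forall>y\<in>D. A (x + y) = A x + A y) \<and> (\<forall>c. \<forall>x\<in>D. A (c *\<^sub>C x) = c *\<^sub>C A x)"

definition closed_operator ::
    "'a::complex_normed_vector set \<Rightarrow> ('a \<Rightarrow> 'b::complex_normed_vector) \<Rightarrow> bool" where
  "closed_operator D A \<longleftrightarrow> closed ((\<lambda>x. (x, A x)) ` D)"

definition densely_defined :: "'a::complex_normed_vector set \<Rightarrow> bool" where
  "densely_defined D \<longleftrightarrow> closure D = UNIV"

definition bounded_clinear ::
    "('a::complex_normed_vector \<Rightarrow> 'b::complex_normed_vector) \<Rightarrow> bool" where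
  "bounded_clinear f \<longleftrightarrow> bounded_linear f \<and> (\<forall>c x. f (c *\<^sub>C x) = c *\<^sub>C f x)"

definition bounded_isomorphism ::
    "('a::complex_normed_vector \<Rightarrow> 'b::complex_normed_vector) \<Rightarrow> bool" where
  "bounded_isomorphism P \<longleftrightarrow> bij P \<and> bounded_clinear P \<and> bounded_clinear (inv P)"

definition resolvent_set ::
    "('x::complex_normed_vector \<Rightarrow> 'z::complex_normed_vector) \<Rightarrow> 'x set \<Rightarrow> ('x \<Rightarrow> 'z) \<Rightarrow> complex set"
  where
  "resolvent_set E D A = {l. \<exists>R. bounded_clinear R \<and>
     (\<forall>z. R z \<in> D \<and> l *\<^sub>C E (R z) - A (R z) = z) \<and>
     (\<forall>x\<in>D. R (l *\<^sub>C E x - A x) = x)}"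


section \<open>Strongly continuous semigroups\<close>

text \<open>The state space is a subspace \<open>V\<close> of the ambient type with its own norm \<open>n\<close>, which need
  not be the norm of the type.\<close>

definition banach_on :: "'a::complex_normed_vector set \<Rightarrow> ('a \<Rightarrow> real) \<Rightarrow> bool" where
  "banach_on V n \<longleftrightarrow> complex_subspace V \<and>
     (\<forall>x\<in>V. 0 \<le> n x \<and> (n x = 0 \<longleftrightarrow> x = 0)) \<and>
     (\<forall>x\<in>V. \<forall>y\<in>V. n (x + y) \<le> n x + n y) \<and>
     (\<forall>c. \<forall>x\<in>V. n (c *\<^sub>C x) = cmod c * n x) \<and>
     (\<forall>u::nat \<Rightarrow> 'a. (\<forall>k. u k \<in> V) \<longrightarrow>
        (\<forall>e>0. \<exists>M. \<forall>k\<ge>M. \<forall>m\<ge>M. n (u k - u m) < e) \<longrightarrow>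
        (\<exists>l\<in>V. (\<lambda>k. n (u k - l)) \<longlonglongrightarrow> 0))"

text \<open>A Banach space densely embedded into the ambient space is identified with its image,
  which carries the transported norm.\<close>

definition densely_embedded_banach :: "'a::complex_normed_vector set \<Rightarrow> ('a \<Rightarrow> real) \<Rightarrow> bool" where
  "densely_embedded_banach V n \<longleftrightarrow>
     banach_on V n \<and> (\<exists>C. \<forall>x\<in>V. norm x \<le> C * n x) \<and> closure V = UNIV"

definition C0_semigroup ::
    "'a::complex_normed_vector set \<Rightarrow> ('a \<Rightarrow> real) \<Rightarrow> (real \<Rightarrow> 'a \<Rightarrow> 'a) \<Rightarrow> bool" where
  "C0_semigroup V n T \<longleftrightarrow>
     (\<forall>t\<ge>0. linear_operator V (T t) \<and> T t ` V \<subseteq> V \<and> (\<exists>K. \<forall>x\<in>V. n (T t x) \<le> K * n x)) \<and>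
     (\<forall>x\<in>V. T 0 x = x) \<and>
     (\<forall>s\<ge>0. \<forall>t\<ge>0. \<forall>x\<in>V. T (s + t) x = T s (T t x)) \<and>
     (\<forall>x\<in>V. ((\<lambda>t. n (T t x - x)) \<longlongrightarrow> 0) (at_right 0))"

definition generator_of ::
    "'a::complex_normed_vector set \<Rightarrow> ('a \<Rightarrow> real) \<Rightarrow> (real \<Rightarrow> 'a \<Rightarrow> 'a) \<Rightarrow> 'a set \<Rightarrow> ('a \<Rightarrow> 'a) \<Rightarrow> bool"
  where
  "generator_of V n T D S \<longleftrightarrow>
     D = {x \<in> V. \<exists>y\<in>V. ((\<lambda>h. n ((1 / h) *\<^sub>R (T h x - x) - y)) \<longlongrightarrow> 0) (at_right 0)} \<and>
     (\<forall>x\<in>D. S x \<in> V \<and> ((\<lambda>h. n ((1 / h) *\<^sub>R (T h x - x) - S x)) \<longlongrightarrow> 0) (at_right 0))"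

definition generates_C0_semigroup ::
    "'a::complex_normed_vector set \<Rightarrow> ('a \<Rightarrow> real) \<Rightarrow> 'a set \<Rightarrow> ('a \<Rightarrow> 'a) \<Rightarrow> bool" where
  "generates_C0_semigroup V n D S \<longleftrightarrow> (\<exists>T. C0_semigroup V n T \<and> generator_of V n T D S)"


section \<open>Differentiation index\<close>

text \<open>A tuple \<open>(x\<^sub>0, \<dots>, x\<^sub>\<mu>\<^sub>+\<^sub>1)\<close> is a sequence of which only the entries with index at most
  \<open>\<mu> + 1\<close> matter; the last of them need not lie in \<open>D\<close>.\<close>

definition ker_M ::
    "('x::complex_normed_vector \<Rightarrow> 'z::complex_normed_vector) \<Rightarrow> 'x set \<Rightarrow> ('x \<Rightarrow> 'z) \<Rightarrow> nat
       \<Rightarrow> (nat \<Rightarrow> 'x) set" where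
  "ker_M E D A \<mu> = {x. (\<forall>i\<le>\<mu>. x i \<in> D) \<and> (\<forall>i\<le>\<mu>. A (x i) - E (x (i + 1)) = 0)}"

definition diff_index_candidate ::
    "('x::complex_normed_vector \<Rightarrow> 'z::complex_normed_vector) \<Rightarrow> 'x set \<Rightarrow> ('x \<Rightarrow> 'z) \<Rightarrow> nat \<Rightarrow> bool"
  where
  "diff_index_candidate E D A \<mu> \<longleftrightarrow>
     (\<exists>V n DS S. densely_embedded_banach V n \<and> generates_C0_semigroup V n DS S \<and>
        (\<forall>x\<in>ker_M E D A \<mu>. x 0 \<in> DS \<and> x 1 = S (x 0)))"

definition diff_index_exists ::
    "('x::complex_normed_vector \<Rightarrow> 'z::complex_normed_vector) \<Rightarrow> 'x set \<Rightarrow> ('x \<Rightarrow> 'z) \<Rightarrow> bool" where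
  "diff_index_exists E D A \<longleftrightarrow> (\<exists>\<mu>. diff_index_candidate E D A \<mu>)"

definition diff_index ::
    "('x::complex_normed_vector \<Rightarrow> 'z::complex_normed_vector) \<Rightarrow> 'x set \<Rightarrow> ('x \<Rightarrow> 'z) \<Rightarrow> nat" where
  "diff_index E D A = (LEAST \<mu>. diff_index_candidate E D A \<mu>)"


section \<open>Chain index\<close>

text \<open>A chain \<open>(x\<^sub>1, \<dots>, x\<^sub>p)\<close> is a sequence of which only the entries with index between \<open>1\<close> and
  \<open>p\<close> matter.\<close>

definition is_chain ::
    "('x::complex_normed_vector \<Rightarrow> 'z::complex_normed_vector) \<Rightarrow> 'x set \<Rightarrow> ('x \<Rightarrow> 'z) \<Rightarrow> nat
       \<Rightarrow> (nat \<Rightarrow> 'x) \<Rightarrow> bool" where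
  "is_chain E D A p x \<longleftrightarrow> 1 \<le> p \<and> (\<forall>k\<in>{1..<p}. x k \<in> D) \<and>
     E (x 1) = 0 \<and> x 1 \<noteq> 0 \<and> (\<forall>k\<in>{1..<p}. A (x k) \<noteq> 0) \<and>
     (\<forall>k\<in>{1..<p}. E (x (k + 1)) = A (x k))"

definition chain_lengths ::
    "('x::complex_normed_vector \<Rightarrow> 'z::complex_normed_vector) \<Rightarrow> 'x set \<Rightarrow> ('x \<Rightarrow> 'z) \<Rightarrow> nat set" where
  "chain_lengths E D A = {p. \<exists>x. is_chain E D A p x}"

definition chain_index_exists ::
    "('x::complex_normed_vector \<Rightarrow> 'z::complex_normed_vector) \<Rightarrow> 'x set \<Rightarrow> ('x \<Rightarrow> 'z) \<Rightarrow> bool" where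
  "chain_index_exists E D A \<longleftrightarrow> bdd_above (chain_lengths E D A)"

text \<open>On \<open>nat\<close> the supremum of the empty set is \<open>0\<close>.\<close>

definition chain_index ::
    "('x::complex_normed_vector \<Rightarrow> 'z::complex_normed_vector) \<Rightarrow> 'x set \<Rightarrow> ('x \<Rightarrow> 'z) \<Rightarrow> nat" where
  "chain_index E D A = Sup (chain_lengths E D A)"


section \<open>Weierstrass form and nilpotency index\<close>

definition equivalent_pairs ::
    "('x::complex_normed_vector \<Rightarrow> 'z::complex_normed_vector) \<Rightarrow> 'x set \<Rightarrow> ('x \<Rightarrow> 'z)
       \<Rightarrow> ('v::complex_normed_vector \<Rightarrow> 'w::complex_normed_vector) \<Rightarrow> 'v set \<Rightarrow> ('v \<Rightarrow> 'w) \<Rightarrow> bool"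
  where
  "equivalent_pairs E D A E' D' A' \<longleftrightarrow>
     (\<exists>P Q. bounded_isomorphism P \<and> bounded_isomorphism Q \<and>
        (\<forall>x. E x = inv Q (E' (P x))) \<and>
        D = {x. P x \<in> D'} \<and> (\<forall>x\<in>D. A x = inv Q (A' (P x))))"

text \<open>On the zero space the identity equals the zero operator, so its degree of nilpotency is
  \<open>0\<close>.\<close>

definition nilpotency_degree :: "('y::complex_normed_vector \<Rightarrow> 'y) \<Rightarrow> nat \<Rightarrow> bool" where
  "nilpotency_degree N p \<longleftrightarrow> (N ^^ p) = (\<lambda>_. 0) \<and> (\<forall>l<p. (N ^^ l) \<noteq> (\<lambda>_. 0))"

definition weierstrass_form ::
    "('x::complex_normed_vector \<Rightarrow> 'z::complex_normed_vector) \<Rightarrow> 'x set \<Rightarrow> ('x \<Rightarrow> 'z)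
       \<Rightarrow> 'y1::complex_hilbert set \<Rightarrow> ('y1 \<Rightarrow> 'y1) \<Rightarrow> ('y2::complex_hilbert \<Rightarrow> 'y2) \<Rightarrow> bool" where
  "weierstrass_form E D A D1 A1 N \<longleftrightarrow>
     linear_operator D1 A1 \<and> bounded_clinear N \<and> (\<exists>p. (N ^^ p) = (\<lambda>_. 0)) \<and>
     equivalent_pairs E D A
       (\<lambda>(y1, y2). (y1, N y2)) (D1 \<times> UNIV) (\<lambda>(y1, y2). (A1 y1, y2))"

text \<open>A definition cannot quantify over types, so the Hilbert space summands of the Weierstrass form
  are passed as type arguments.\<close>

definition has_nilpotency_index ::
    "'y1::complex_hilbert itself \<Rightarrow> 'y2::complex_hilbert itself
       \<Rightarrow> ('x::complex_normed_vector \<Rightarrow> 'z::complex_normed_vector) \<Rightarrow> 'x set \<Rightarrow> ('x \<Rightarrow> 'z) \<Rightarrow> nat \<Rightarrow> bool"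
  where
  "has_nilpotency_index TY1 TY2 E D A p \<longleftrightarrow>
     (\<exists>D1 (A1 :: 'y1 \<Rightarrow> 'y1) (N :: 'y2 \<Rightarrow> 'y2).
        weierstrass_form E D A D1 A1 N \<and> nilpotency_degree N p)"

end

theory Submission
  imports Defs
begin

text \<open>For (a), a chain \<open>(x\<^sub>1, \<dots>, x\<^sub>\<mu>\<^sub>+\<^sub>1)\<close> would put \<open>(0, x\<^sub>1, \<dots>, x\<^sub>\<mu>\<^sub>+\<^sub>1)\<close> into the kernel of
  \<open>M\<^sub>\<mu>\<close>, so a differentiation index \<open>\<mu>\<close> forces \<open>x\<^sub>1 = S 0 = 0\<close>. For (b), in Weierstrass coordinates
  a chain lives in the nilpotent block and satisfies \<open>N y\<^sub>k\<^sub>+\<^sub>1 = y\<^sub>k\<close>, so the nilpotency degree is the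
  chain index, whichever Weierstrass form is used; by (a) it is a lower bound for the
  differentiation index. It is attained: for a tuple in the kernel of \<open>M\<^sub>p\<close> the nilpotent components
  of \<open>x\<^sub>0\<close> and \<open>x\<^sub>1\<close> are \<open>N\<^sup>p\<^sup>+\<^sup>1 v\<close> and \<open>N\<^sup>p v\<close>, hence vanish, so the generator \<open>A\<^sub>1 \<oplus> 0\<close> works.\<close>

section \<open>Elementary facts on linear operators\<close>

lemma linear_operator_0:
  assumes "linear_operator D A"
  shows "0 \<in> D" "A 0 = 0"
proof -
  show D: "0 \<in> D"
    using assms by (simp add: linear_operator_def complex_subspace_def)
  have "A (0 + 0) = A 0 + A 0"
    using assms D unfolding linear_operator_def by blast
  then show "A 0 = 0"
    by simp
qed

lemma bounded_clinear_imp_linear: "bounded_clinear f \<Longrightarrow> linear f"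
  by (simp add: bounded_clinear_def bounded_linear.linear)

lemma bounded_clinear_scaleC: "bounded_clinear f \<Longrightarrow> f (c *\<^sub>C x) = c *\<^sub>C f x"
  by (simp add: bounded_clinear_def)


section \<open>Chain index and differentiation index\<close>

text \<open>\<open>generator_of\<close> does not assert linearity of \<open>S\<close>; the value
  comes from uniqueness of limits, since all difference quotients at 0 vanish.\<close>

lemma generator_of_0:
  assumes V: "banach_on V n" and T: "C0_semigroup V n T" and S: "generator_of V n T D S"
  shows "S 0 = 0"
proof -
  have T0: "T h 0 = 0" if "h \<ge> 0" for h
    using T that linear_operator_0(2) unfolding C0_semigroup_def by blast
  have n_uminus: "n (- x) = n x" if "x \<in> V" for x
  proof -
    \<comment> \<open>Homogeneity of \<open>n\<close> is stated for \<open>scaleC\<close>, so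
      negation enters as scaling by -1.\<close>
    have "(- 1) *\<^sub>C x = - x"
      using scaleC_of_real[of "- 1" x] by simp
    then show ?thesis
      using V that unfolding banach_on_def by (metis mult_1 norm_minus_cancel norm_one)
  qed
  have "0 \<in> V"
    using V by (simp add: banach_on_def complex_subspace_def)
  moreover have "n 0 = 0"
    using V \<open>0 \<in> V\<close> by (simp add: banach_on_def)
  moreover have "eventually (\<lambda>h::real. n ((1 / h) *\<^sub>R (T h 0 - 0) - 0) = 0) (at_right 0)"
    using eventually_at_right_less[of "0::real"]
    by eventually_elim (simp add: T0 \<open>n 0 = 0\<close>)
  ultimately have "0 \<in> D"
    using S unfolding generator_of_def by (auto intro!: bexI[of _ 0] tendsto_eventually)
  then have SV: "S 0 \<in> V"
    and lim: "((\<lambda>h. n ((1 / h) *\<^sub>R (T h 0 - 0) - S 0)) \<longlongrightarrow> 0) (at_right 0)"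
    using S unfolding generator_of_def by blast+
  \<comment> \<open>For h > 0 the quotient is 0, so the expression is the constant
    \<open>n (- S 0)\<close>; its limit must be the 0 of \<open>lim\<close>.\<close>
  have "eventually (\<lambda>h::real. n ((1 / h) *\<^sub>R (T h 0 - 0) - S 0) = n (S 0)) (at_right 0)"
    using eventually_at_right_less[of "0::real"]
    by eventually_elim (simp add: T0 n_uminus SV)
  then have "((\<lambda>h. n ((1 / h) *\<^sub>R (T h 0 - 0) - S 0)) \<longlongrightarrow> n (S 0)) (at_right 0)"
    by (rule tendsto_eventually)
  with lim have "n (S 0) = 0"
    using tendsto_unique[OF trivial_limit_at_right_real] by blast
  then show ?thesis
    using V SV by (simp add: banach_on_def)
qed

lemma diff_index_candidate_bounds_chains:
  assumes A: "linear_operator D A" and cand: "diff_index_candidate E D A \<mu>"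
    and chain: "is_chain E D A p x"
  shows "p \<le> \<mu>"
proof (rule ccontr)
  assume "\<not> p \<le> \<mu>"
  then have p: "\<mu> < p"
    by simp
  obtain V n DS S where "densely_embedded_banach V n" "generates_C0_semigroup V n DS S"
    and S: "\<And>z. z \<in> ker_M E D A \<mu> \<Longrightarrow> z 1 = S (z 0)"
    using cand unfolding diff_index_candidate_def by blast
  then have "S 0 = 0"
    unfolding densely_embedded_banach_def generates_C0_semigroup_def
    using generator_of_0 by blast
  \<comment> \<open>Prefixing 0 turns \<open>E (x 1) = 0\<close> into the equation at index 0; those
    at indices 1 to \<open>\<mu>\<close> are chain equations because
    \<open>\<mu> < p\<close>.\<close>
  define z where "z i = (if i = 0 then 0 else x i)" for i
  have "z i \<in> D \<and> A (z i) - E (z (i + 1)) = 0" if "i \<le> \<mu>" for i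
    using chain p that linear_operator_0[OF A] by (auto simp: z_def is_chain_def)
  then have "z \<in> ker_M E D A \<mu>"
    by (simp add: ker_M_def)
  then have "x 1 = 0"
    using S \<open>S 0 = 0\<close> by (fastforce simp: z_def)
  then show False
    using chain by (simp add: is_chain_def)
qed

lemma chain_index_le_diff_index:
  assumes "linear_operator D A" and "diff_index_exists E D A"
  shows "chain_index_exists E D A" "chain_index E D A \<le> diff_index E D A"
proof -
  have "diff_index_candidate E D A (diff_index E D A)"
    using assms(2) unfolding diff_index_exists_def diff_index_def by (rule LeastI_ex)
  then have le: "p \<le> diff_index E D A" if "p \<in> chain_lengths E D A" for p
    using diff_index_candidate_bounds_chains[OF assms(1)] that
    by (auto simp: chain_lengths_def)
  then show "chain_index_exists E D A"
    unfolding chain_index_exists_def by (rule bdd_aboveI)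
  show "chain_index E D A \<le> diff_index E D A"
  \<comment> \<open>\<open>cSup_least\<close> needs a nonempty set; without chains
    \<open>Sup\<close> takes its default value 0.\<close>
  proof (cases "chain_lengths E D A = {}")
    case True
    then show ?thesis
      by (simp add: chain_index_def Sup_nat_def)
  next
    case False
    then show ?thesis
      using le unfolding chain_index_def by (rule cSup_least)
  qed
qed


section \<open>Weierstrass coordinates\<close>

text \<open>Cancelling the injective \<open>inv Q\<close> makes equations between values of
  \<open>E\<close> and \<open>A\<close> componentwise, so that only \<open>P\<close> has to be
  carried along.\<close>

lemma weierstrass_form_coordinates:
  assumes "weierstrass_form E D A D1 A1 N"
  obtains P where "bounded_isomorphism P" "D = {x. fst (P x) \<in> D1}"
    "\<forall>x. E x = 0 \<longleftrightarrow> fst (P x) = 0 \<and> N (snd (P x)) = 0"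
    "\<forall>x\<in>D. A x = 0 \<longleftrightarrow> A1 (fst (P x)) = 0 \<and> snd (P x) = 0"
    "\<forall>x\<in>D. \<forall>y. E y = A x \<longleftrightarrow> fst (P y) = A1 (fst (P x)) \<and> N (snd (P y)) = snd (P x)"
proof -
  obtain P Q where P: "bounded_isomorphism P" and Q: "bounded_isomorphism Q"
    and E: "\<And>x. E x = inv Q (fst (P x), N (snd (P x)))"
    and D: "D = {x. fst (P x) \<in> D1}"
    and A: "\<And>x. x \<in> D \<Longrightarrow> A x = inv Q (A1 (fst (P x)), snd (P x))"
    using assms unfolding weierstrass_form_def equivalent_pairs_def
    by (auto simp: case_prod_unfold mem_Times_iff)
  have inj: "inv Q a = inv Q b \<longleftrightarrow> a = b" for a b
    using Q bij_imp_bij_inv unfolding bounded_isomorphism_def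
    by (metis bij_def inj_eq)
  have "linear (inv Q)"
    using Q bounded_clinear_imp_linear by (auto simp: bounded_isomorphism_def)
  then have zero: "inv Q a = 0 \<longleftrightarrow> a = 0" for a
    using inj[of a 0] linear_0 by metis
  show ?thesis
    by (rule that[OF P D]) (auto simp: E A inj zero prod_eq_iff)
qed

section \<open>Iterates of the nilpotent block and chain lengths\<close>

lemma funpow_fixes_0: "f 0 = 0 \<Longrightarrow> (f ^^ k) 0 = 0" for f :: "'a::zero \<Rightarrow> 'a"
  by (induction k) auto

text \<open>Nilpotent components of chains and of kernel tuples both satisfy this recursion; reading
  it from the last entry backwards brings in powers of \<open>N\<close>.\<close>

lemma backward_orbit_eq_funpow:
  assumes "\<And>i. i < k \<Longrightarrow> f (v (Suc i)) = v i" and "j \<le> k"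
  shows "v (k - j) = (f ^^ j) (v k)"
  using assms(2)
proof (induction j)
  case (Suc j)
  then have "v (k - Suc j) = f (v (k - j))"
    using assms(1)[of "k - Suc j"] by (simp add: Suc_diff_Suc)
  with Suc show ?case
    by simp
qed simp

text \<open>The first components of a chain start at 0 and stay there because
  \<open>A1 0 = 0\<close>, so only \<open>N\<close> limits the length. A longer chain would start
  with an image under \<open>N ^^ p\<close>, hence with 0; a single orbit of \<open>N\<close>
  supplies all shorter ones.\<close>

lemma weierstrass_form_chain_lengths:
  assumes W: "weierstrass_form E D A D1 A1 N" and N: "nilpotency_degree N p"
  shows "chain_lengths E D A = {1..p}"
proof -
  obtain P where P: "bounded_isomorphism P" and D: "D = {x. fst (P x) \<in> D1}"
    and E0: "\<forall>x. E x = 0 \<longleftrightarrow> fst (P x) = 0 \<and> N (snd (P x)) = 0"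
    and A0: "\<forall>x\<in>D. A x = 0 \<longleftrightarrow> A1 (fst (P x)) = 0 \<and> snd (P x) = 0"
    and EA: "\<forall>x\<in>D. \<forall>y.
      E y = A x \<longleftrightarrow> fst (P y) = A1 (fst (P x)) \<and> N (snd (P y)) = snd (P x)"
    using W by (rule weierstrass_form_coordinates)
  have A1: "0 \<in> D1" "A1 0 = 0"
    using W linear_operator_0 by (auto simp: weierstrass_form_def)
  have N0: "N 0 = 0"
    using W linear_0[OF bounded_clinear_imp_linear] by (auto simp: weierstrass_form_def)
  have P_inv [simp]: "P (inv P y) = y" for y
    using P by (simp add: bounded_isomorphism_def bij_is_surj surj_f_inv_f)
  have P0: "x = 0" if "P x = 0" for x
    using P that linear_0[OF bounded_clinear_imp_linear]
    by (metis bij_def bounded_isomorphism_def inj_eq)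
  have Np: "(N ^^ p) y = 0" for y
    using N by (simp add: nilpotency_degree_def fun_eq_iff)
  have "q \<le> p" if chain: "is_chain E D A q x" for q x
  proof (rule ccontr)
    assume "\<not> q \<le> p"
    \<comment> \<open>Shifted so that \<open>v 0\<close> belongs to the first chain entry;
      \<open>p < q\<close> makes \<open>v p\<close> available.\<close>
    define v where "v i = snd (P (x (Suc i)))" for i
    have fst_x: "fst (P (x (Suc i))) = 0" if "i < q" for i
      using that
    proof (induction i)
      case 0
      then show ?case
        using chain E0 by (simp add: is_chain_def)
    next
      case (Suc i)
      then have "x (Suc i) \<in> D" "E (x (Suc (Suc i))) = A (x (Suc i))"
        using chain by (auto simp: is_chain_def)
      then show ?case
        using EA Suc A1 by simp
    qed
    have "N (v (Suc i)) = v i" if "i < p" for i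
    proof -
      have "x (Suc i) \<in> D" "E (x (Suc (Suc i))) = A (x (Suc i))"
        using chain \<open>\<not> q \<le> p\<close> that by (auto simp: is_chain_def)
      then show ?thesis
        using EA by (simp add: v_def)
    qed
    from backward_orbit_eq_funpow[of p N v p, OF this] have "v 0 = 0"
      by (simp add: Np)
    then have "P (x 1) = 0"
      using fst_x[of 0] chain by (simp add: v_def is_chain_def prod_eq_iff)
    then show False
      using P0 chain by (auto simp: is_chain_def)
  qed
  moreover have "\<exists>x. is_chain E D A q x" if q: "1 \<le> q" "q \<le> p" for q
  proof -
    \<comment> \<open>Here \<open>1 \<le> p\<close>, so \<open>p - 1\<close> lies below the degree
      and minimality applies.\<close>
    obtain y where y: "(N ^^ (p - 1)) y \<noteq> 0"
      using N q unfolding nilpotency_degree_def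
      by (metis diff_less le_trans less_numeral_extra(1) less_le_trans)
    \<comment> \<open>In the second component, \<open>N\<close> maps entry \<open>k + 1\<close> to
      entry \<open>k\<close> and annihilates entry 1.\<close>
    define x where "x k = inv P (0, (N ^^ (p - k)) y)" for k
    have nz: "(N ^^ (p - k)) y \<noteq> 0" if "1 \<le> k" "k \<le> p" for k
    proof
      assume "(N ^^ (p - k)) y = 0"
      \<comment> \<open>The exponents add up to \<open>p - 1\<close>, contradicting the choice of
        \<open>y\<close>.\<close>
      then have "(N ^^ ((k - 1) + (p - k))) y = 0"
        by (simp add: funpow_add funpow_fixes_0 N0)
      then show False
        using y that by simp
    qed
    have step: "N ((N ^^ (p - Suc k)) y) = (N ^^ (p - k)) y" if "k < p" for k
      using that by (metis Suc_diff_Suc funpow.simps(2) o_apply)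
    have xD: "x k \<in> D" for k
      by (simp add: D x_def A1)
    have "x 1 \<noteq> 0"
    proof
      assume "x 1 = 0"
      then have "P (x 1) = 0"
        using P linear_0[OF bounded_clinear_imp_linear, of P]
        by (simp add: bounded_isomorphism_def)
      then show False
        using nz[of 1] q by (simp add: x_def prod_eq_iff)
    qed
    moreover have "E (x 1) = 0"
      using step[of 0] q Np by (simp add: E0 x_def)
    moreover have "A (x k) \<noteq> 0" if "k \<in> {1..<q}" for k
      using nz[of k] that q A0 xD[of k] by (simp add: x_def)
    moreover have "E (x (k + 1)) = A (x k)" if "k \<in> {1..<q}" for k
      using step[of k] that q EA xD[of k] A1 by (simp add: x_def)
    ultimately have "is_chain E D A q x"
      using q xD by (simp add: is_chain_def)
    then show ?thesis by blast
  qed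
  ultimately show ?thesis
    by (auto simp: chain_lengths_def is_chain_def)
qed

lemma weierstrass_form_chain_index:
  assumes "weierstrass_form E D A D1 A1 N" and "nilpotency_degree N p"
  shows "chain_index E D A = p"
  \<comment> \<open>For \<open>p = 0\<close> the set \<open>{1..p}\<close> is empty and its
    \<open>Sup\<close> is 0; otherwise \<open>p\<close> is its maximum.\<close>
  by (cases "p = 0")
    (auto simp: chain_index_def weierstrass_form_chain_lengths[OF assms] Sup_nat_def
      intro!: Max_eqI)

text \<open>\<open>weierstrass_form\<close> provides only some vanishing power; the least such
  exponent is the degree.\<close>

lemma nilpotency_degree_exists:
  assumes "(N ^^ p) = (\<lambda>_. 0)"
  shows "\<exists>q. nilpotency_degree N q"
  using LeastI[of "\<lambda>q. (N ^^ q) = (\<lambda>_. 0)", OF assms] not_less_Least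
  unfolding nilpotency_degree_def by blast


section \<open>Semigroups in Weierstrass coordinates\<close>

lemma C0_semigroup_UNIV_iff:
  "C0_semigroup UNIV n T \<longleftrightarrow>
    (\<forall>t\<ge>0. \<forall>x y. T t (x + y) = T t x + T t y) \<and>
    (\<forall>t\<ge>0. \<forall>c x. T t (c *\<^sub>C x) = c *\<^sub>C T t x) \<and>
    (\<forall>t\<ge>0. \<exists>K. \<forall>x. n (T t x) \<le> K * n x) \<and>
    (\<forall>x. T 0 x = x) \<and>
    (\<forall>s\<ge>0. \<forall>t\<ge>0. \<forall>x. T (s + t) x = T s (T t x)) \<and>
    (\<forall>x. ((\<lambda>t. n (T t x - x)) \<longlongrightarrow> 0) (at_right 0))"
  unfolding C0_semigroup_def linear_operator_def complex_subspace_def by simp blast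

text \<open>The witness is the direct sum of the semigroup of \<open>A1\<close> and the identity
  semigroup, whose generator is 0 on the whole space.\<close>

lemma generates_C0_semigroup_Times_zero:
  fixes A1 :: "'a::complex_normed_vector \<Rightarrow> 'a"
  assumes "generates_C0_semigroup UNIV norm D1 A1"
  shows "generates_C0_semigroup UNIV norm (D1 \<times> UNIV)
    (\<lambda>y :: 'a \<times> 'b::complex_normed_vector. (A1 (fst y), 0))"
proof -
  obtain T where T: "C0_semigroup UNIV norm T" and gen: "generator_of UNIV norm T D1 A1"
    using assms unfolding generates_C0_semigroup_def by blast
  define U :: "real \<Rightarrow> 'a \<times> 'b \<Rightarrow> 'a \<times> 'b" where "U t y = (T t (fst y), snd y)" for t y
  have bounded: "\<exists>K. \<forall>y. norm (U t y) \<le> K * norm y" if "t \<ge> 0" for t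
  proof -
    have "\<exists>K. \<forall>x. norm (T t x) \<le> K * norm x"
      using T that by (simp add: C0_semigroup_UNIV_iff)
    then obtain K where K: "\<And>x. norm (T t x) \<le> K * norm x"
      by blast
    \<comment> \<open>The absolute value guards against a negative \<open>K\<close>; the summand 1
      accounts for the identity on the second component.\<close>
    have "norm (U t y) \<le> (\<bar>K\<bar> + 1) * norm y" for y
    proof -
      have "norm (U t y) \<le> norm (T t (fst y)) + norm (snd y)"
        using norm_Pair_le by (simp add: U_def)
      also have "\<dots> \<le> \<bar>K\<bar> * norm (fst y) + norm (snd y)"
        using K[of "fst y"] mult_right_mono[OF abs_ge_self[of K] norm_ge_zero[of "fst y"]]
        by linarith
      also have "\<dots> \<le> \<bar>K\<bar> * norm y + norm y"
        using norm_fst_le[of "fst y" "snd y"] norm_snd_le[of "snd y" "fst y"]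
        by (intro add_mono mult_left_mono) simp_all
      finally show ?thesis
        by (simp add: algebra_simps)
    qed
    then show ?thesis
      by blast
  qed
  have "C0_semigroup UNIV norm U"
    using T bounded unfolding C0_semigroup_UNIV_iff
    by (simp add: U_def scaleC_prod_def minus_prod_def)
  moreover have "generator_of UNIV norm U (D1 \<times> UNIV) (\<lambda>y. (A1 (fst y), 0))"
  proof -
    have lim: "((\<lambda>h. norm ((1 / h) *\<^sub>R (U h y - y) - (a, 0))) \<longlongrightarrow> 0) (at_right 0)"
      if "((\<lambda>h. norm ((1 / h) *\<^sub>R (T h (fst y) - fst y) - a)) \<longlongrightarrow> 0) (at_right 0)" for y a
      using that by (simp add: U_def minus_prod_def)
    \<comment> \<open>The norm of a pair dominates that of its first component, so a derivative of
      an orbit of \<open>U\<close> yields one of \<open>T\<close>. This keeps the domain of the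
      generator inside \<open>D1 \<times> UNIV\<close>.\<close>
    have lim_fst: "((\<lambda>h. norm ((1 / h) *\<^sub>R (T h (fst y) - fst y) - fst b)) \<longlongrightarrow> 0) (at_right 0)"
      if "((\<lambda>h. norm ((1 / h) *\<^sub>R (U h y - y) - b)) \<longlongrightarrow> 0) (at_right 0)" for y b
    proof (rule Lim_null_comparison[OF _ that], rule always_eventually, rule allI)
      fix h
      show "norm (norm ((1 / h) *\<^sub>R (T h (fst y) - fst y) - fst b))
          \<le> norm ((1 / h) *\<^sub>R (U h y - y) - b)"
        by (simp add: U_def norm_prod_def)
    qed
    have "D1 \<times> UNIV = {y. \<exists>b. ((\<lambda>h. norm ((1 / h) *\<^sub>R (U h y - y) - b)) \<longlongrightarrow> 0) (at_right 0)}"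
      (is "_ = {y. \<exists>b. ?lim y b}")
    proof (intro set_eqI iffI)
      fix y :: "'a \<times> 'b"
      assume "y \<in> D1 \<times> UNIV"
      then have "?lim y (A1 (fst y), 0)"
        using gen lim by (simp add: generator_of_def mem_Times_iff)
      then show "y \<in> {y. \<exists>b. ?lim y b}"
        by blast
    next
      fix y
      assume "y \<in> {y. \<exists>b. ?lim y b}"
      then obtain b where "?lim y b"
        by blast
      from lim_fst[OF this] have "fst y \<in> D1"
        using gen unfolding generator_of_def by blast
      then show "y \<in> D1 \<times> UNIV"
        by (simp add: mem_Times_iff)
    qed
    moreover have "\<forall>y\<in>D1 \<times> UNIV.
        ((\<lambda>h. norm ((1 / h) *\<^sub>R (U h y - y) - (A1 (fst y), 0))) \<longlongrightarrow> 0) (at_right 0)"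
      using gen lim by (simp add: generator_of_def mem_Times_iff)
    ultimately show ?thesis
      by (simp add: generator_of_def)
  qed
  ultimately show ?thesis
    unfolding generates_C0_semigroup_def by blast
qed

text \<open>For the pulled-back norm \<open>P\<close> is an isometry, so bounds and limits for the
  conjugated semigroup are literally those for \<open>T\<close>.\<close>

lemma generates_C0_semigroup_conjugate:
  assumes P: "bounded_isomorphism P" and "generates_C0_semigroup UNIV norm D S"
  shows "generates_C0_semigroup UNIV (\<lambda>x. norm (P x)) {x. P x \<in> D} (\<lambda>x. inv P (S (P x)))"
proof -
  obtain T where T: "C0_semigroup UNIV norm T" and gen: "generator_of UNIV norm T D S"
    using assms unfolding generates_C0_semigroup_def by blast
  define U where "U t x = inv P (T t (P x))" for t x
  have P_inv [simp]: "P (inv P y) = y" "inv P (P x) = x" for x y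
    using P by (auto simp: bounded_isomorphism_def bij_is_surj bij_is_inj surj_f_inv_f)
  have lin: "linear P" "linear (inv P)"
    using P bounded_clinear_imp_linear by (auto simp: bounded_isomorphism_def)
  note P_lin = linear_add[OF lin(1)] linear_add[OF lin(2)] linear_diff[OF lin(1)]
    linear_scale[OF lin(1)]
  have clin: "P (c *\<^sub>C x) = c *\<^sub>C P x" "inv P (c *\<^sub>C y) = c *\<^sub>C inv P y" for c x y
    using P bounded_clinear_scaleC by (auto simp: bounded_isomorphism_def)
  have "\<exists>K. \<forall>x. norm (P (U t x)) \<le> K * norm (P x)" if "t \<ge> 0" for t
    using T that unfolding C0_semigroup_UNIV_iff U_def P_inv by metis
  then have "C0_semigroup UNIV (\<lambda>x. norm (P x)) U"
    using T unfolding C0_semigroup_UNIV_iff by (simp add: U_def P_lin clin)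
  moreover have "generator_of UNIV (\<lambda>x. norm (P x)) U {x. P x \<in> D} (\<lambda>x. inv P (S (P x)))"
  proof -
    \<comment> \<open>By surjectivity of \<open>P\<close>, candidate derivatives may be sought among
      the images \<open>P y\<close>.\<close>
    have ex_P: "(\<exists>y. Q y) \<longleftrightarrow> (\<exists>y. Q (P y))" for Q
      by (metis P_inv(1))
    have "(\<exists>y. ((\<lambda>h. norm ((1 / h) *\<^sub>R (T h (P x) - P x) - y)) \<longlongrightarrow> 0) (at_right 0)) \<longleftrightarrow>
        (\<exists>y. ((\<lambda>h. norm ((1 / h) *\<^sub>R (T h (P x) - P x) - P y)) \<longlongrightarrow> 0) (at_right 0))" for x
      by (rule ex_P)
    then show ?thesis
      using gen by (simp add: generator_of_def U_def P_lin)
  qed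
  ultimately show ?thesis
    unfolding generates_C0_semigroup_def by blast
qed

text \<open>Completeness is inherited from the codomain of \<open>P\<close>, and a bound of
  \<open>inv P\<close> serves as embedding constant.\<close>

lemma densely_embedded_banach_isomorphism:
  fixes P :: "'a::complex_normed_vector \<Rightarrow> 'b::complex_banach"
  assumes P: "bounded_isomorphism P"
  shows "densely_embedded_banach UNIV (\<lambda>x. norm (P x))"
proof -
  have P_inv [simp]: "P (inv P y) = y" "inv P (P x) = x" for x y
    using P by (auto simp: bounded_isomorphism_def bij_is_surj bij_is_inj surj_f_inv_f)
  have lin: "linear P" and clin: "P (c *\<^sub>C x) = c *\<^sub>C P x" for c x
    using P bounded_clinear_imp_linear bounded_clinear_scaleC
    by (auto simp: bounded_isomorphism_def)
  have "P x = 0 \<longleftrightarrow> x = 0" for x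
    using linear_0[OF lin] by (metis P_inv(2))
  moreover have "\<exists>l. (\<lambda>k. norm (P (u k - l))) \<longlonglongrightarrow> 0"
    if "\<forall>e>0. \<exists>M. \<forall>k\<ge>M. \<forall>m\<ge>M. norm (P (u k - u m)) < e" for u :: "nat \<Rightarrow> 'a"
  proof -
    have "Cauchy (\<lambda>k. P (u k))"
      using that by (simp add: Cauchy_def dist_norm linear_diff[OF lin])
    then obtain l where "(\<lambda>k. P (u k)) \<longlonglongrightarrow> l"
      using Cauchy_convergent convergent_def by blast
    then have "(\<lambda>k. norm (P (u k - inv P l))) \<longlonglongrightarrow> 0"
      by (simp add: linear_diff[OF lin] tendsto_norm_zero_iff Lim_null[symmetric])
    then show ?thesis ..
  qed
  ultimately have "banach_on UNIV (\<lambda>x. norm (P x))"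
    by (simp add: banach_on_def complex_subspace_def linear_add[OF lin] clin norm_scaleC
        norm_triangle_ineq)
  moreover have "\<exists>C. \<forall>x. norm x \<le> C * norm (P x)"
  proof -
    obtain C where "\<And>y. norm (inv P y) \<le> norm y * C"
      using P bounded_linear.bounded unfolding bounded_isomorphism_def bounded_clinear_def
      by blast
    then have "norm x \<le> C * norm (P x)" for x
      by (metis P_inv(2) mult.commute)
    then show ?thesis
      by blast
  qed
  ultimately show ?thesis
    by (simp add: densely_embedded_banach_def)
qed

lemma weierstrass_form_diff_index_candidate:
  assumes W: "weierstrass_form E D A D1 A1 N" and N: "nilpotency_degree N p"
    and gen: "generates_C0_semigroup UNIV norm D1 A1"
  shows "diff_index_candidate E D A p"
proof -
  obtain P where P: "bounded_isomorphism P" and D: "D = {x. fst (P x) \<in> D1}"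
    and "\<forall>x. E x = 0 \<longleftrightarrow> fst (P x) = 0 \<and> N (snd (P x)) = 0"
    and "\<forall>x\<in>D. A x = 0 \<longleftrightarrow> A1 (fst (P x)) = 0 \<and> snd (P x) = 0"
    and EA: "\<forall>x\<in>D. \<forall>y.
      E y = A x \<longleftrightarrow> fst (P y) = A1 (fst (P x)) \<and> N (snd (P y)) = snd (P x)"
    using W by (rule weierstrass_form_coordinates)
  have P_inv: "inv P (P x) = x" for x
    using P by (simp add: bounded_isomorphism_def bij_is_inj)
  \<comment> \<open>This is \<open>A1\<close> plus the zero operator, carried back by
    \<open>P\<close>; its domain leaves the nilpotent component of \<open>x 0\<close> free.\<close>
  let ?S = "\<lambda>x. inv P (A1 (fst (P x)), 0)"
  have "x 0 \<in> {x. P x \<in> D1 \<times> UNIV} \<and> x 1 = ?S (x 0)" if x: "x \<in> ker_M E D A p" for x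
  proof -
    have xD: "x i \<in> D" and step: "fst (P (x (Suc i))) = A1 (fst (P (x i)))"
        "N (snd (P (x (Suc i)))) = snd (P (x i))" if "i \<le> p" for i
    proof -
      show "x i \<in> D"
        using x that by (simp add: ker_M_def)
      moreover have "E (x (Suc i)) = A (x i)"
        using x that by (simp add: ker_M_def)
      ultimately show "fst (P (x (Suc i))) = A1 (fst (P (x i)))"
        "N (snd (P (x (Suc i)))) = snd (P (x i))"
        using EA by blast+
    qed
    \<comment> \<open>The tuple ends at index \<open>p + 1\<close>, so \<open>p\<close> steps back
      lead exactly to \<open>x 1\<close>, whose nilpotent component is thus an image under
      \<open>N ^^ p\<close>.\<close>
    have "snd (P (x (Suc p - p))) = (N ^^ p) (snd (P (x (Suc p))))"
      by (rule backward_orbit_eq_funpow[where k = "Suc p" and v = "\<lambda>i. snd (P (x i))"])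
        (simp_all add: step)
    then have "snd (P (x 1)) = 0"
      using N by (simp add: nilpotency_degree_def)
    with step(1)[of 0] have "P (x 1) = (A1 (fst (P (x 0))), 0)"
      by (simp add: prod_eq_iff)
    then have "x 1 = ?S (x 0)"
      by (metis P_inv)
    with xD[of 0] show ?thesis
      by (simp add: D mem_Times_iff)
  qed
  then show ?thesis
    using densely_embedded_banach_isomorphism[OF P]
      generates_C0_semigroup_conjugate[OF P generates_C0_semigroup_Times_zero[OF gen]]
    unfolding diff_index_candidate_def by blast
qed

theorem proposition7p6:
  fixes E :: "'x::complex_banach \<Rightarrow> 'z::complex_banach"
    and D :: "'x set" and A :: "'x \<Rightarrow> 'z"
  assumes "bounded_clinear E"
    and "linear_operator D A" and "closed_operator D A" and "densely_defined D"
    and "resolvent_set E D A \<noteq> {}"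
  shows "(diff_index_exists E D A \<longrightarrow>
            chain_index_exists E D A \<and> chain_index E D A \<le> diff_index E D A) \<and>
         (\<forall>p D1 (A1 :: 'y1::complex_hilbert \<Rightarrow> 'y1) (N :: 'y2::complex_hilbert \<Rightarrow> 'y2).
            has_nilpotency_index TYPE('u1::complex_hilbert) TYPE('u2::complex_hilbert) E D A p \<longrightarrow>
            weierstrass_form E D A D1 A1 N \<longrightarrow>
            generates_C0_semigroup UNIV norm D1 A1 \<longrightarrow>
            diff_index_exists E D A \<and> p = diff_index E D A)"
proof (intro conjI impI allI)
  assume "diff_index_exists E D A"
  then show "chain_index_exists E D A" "chain_index E D A \<le> diff_index E D A"
    by (rule chain_index_le_diff_index[OF assms(2)])+
next
  fix p D1 and A1 :: "'y1 \<Rightarrow> 'y1" and N :: "'y2 \<Rightarrow> 'y2"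
  assume p: "has_nilpotency_index TYPE('u1) TYPE('u2) E D A p"
    and W: "weierstrass_form E D A D1 A1 N"
    and gen: "generates_C0_semigroup UNIV norm D1 A1"
  \<comment> \<open>The number \<open>p\<close> may stem from a Weierstrass form over other spaces
    than \<open>A1\<close> and \<open>N\<close>. The chain index refers to no form and so identifies
    \<open>p\<close> with \<open>q\<close>.\<close>
  obtain q where q: "nilpotency_degree N q"
    using W nilpotency_degree_exists unfolding weierstrass_form_def by blast
  have p_chain: "chain_index E D A = p"
    using p weierstrass_form_chain_index unfolding has_nilpotency_index_def by blast
  moreover have "chain_index E D A = q"
    using W q by (rule weierstrass_form_chain_index)
  ultimately have cand: "diff_index_candidate E D A p"
    using weierstrass_form_diff_index_candidate[OF W q gen] by simp
  then show ex: "diff_index_exists E D A"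
    by (auto simp: diff_index_exists_def)
  \<comment> \<open>Being a candidate bounds the least one from above; the chain index
    \<open>p\<close> bounds it from below.\<close>
  have "diff_index E D A \<le> p"
    unfolding diff_index_def using cand by (rule Least_le)
  then show "p = diff_index E D A"
    using chain_index_le_diff_index(2)[OF assms(2) ex] p_chain by simp
qed

end
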